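(* Consider the crowdsourcing scheduling problem described in the context. The inequality $$WCT_{OPT}\geq \frac{1}{m}M_{1}+\frac{m-1}{2m}M_{n}+M_{\Lambda}$$ does not necessarily hold. That is, there exist an instance (numbers $m,n$, rates $\lambda_j>0$, service times $\tau_i>0$, weights $w_i>0$), an indexing $s_1,\dots,s_n$ of the tasks with $\frac{w_1}{\tau_1}\ge\cdots\ge\frac{w_n}{\tau_n}$, and the assignment $\Lambda=\{\mathcal{S}_1,\dots,\mathcal{S}_m\}$ produced by the LRF algorithm run with this task order, such that $$WCT_{OPT}< \frac{1}{m}M_{1}+\frac{m-1}{2m}M_{n}+M_{\Lambda},$$ where $M_{1}=\sum_{j=1}^{n}\sum_{i\leq j} w_{j}\tau_{i}$, $M_{n}=\sum_{i=1}^{n}w_{i}\tau_{i}$ and $M_{\Lambda}=\sum_{j=1}^{m}\sum_{s_{i}\in \mathcal{S}_{j}}w_{i}\cdot \frac{2}{\lambda_{j}}$.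
   Context: Crowdsourcing scheduling problem: there are $m\ge 1$ crowd workers $u_1,\dots,u_m$, worker $u_j$ having a rate $\lambda_j>0$, and $n$ indivisible tasks $s_1,\dots,s_n$, task $s_i$ having required service time $\tau_i>0$ and weight $w_i>0$. A schedule partitions the tasks into disjoint sets $\mathcal{S}_1,\dots,\mathcal{S}_m$ ($\mathcal{S}_j$ is processed by $u_j$) and fixes a processing order within each $\mathcal{S}_j$; each worker processes its tasks sequentially. If $s_i\in\mathcal{S}_j$, its completion time is $C_i=\frac{2}{\lambda_j}+\sum\tau_k$, the sum over all tasks $s_k\in\mathcal{S}_j$ processed before $s_i$ together with $s_i$ itself. The total weighted completion time is $\sum_{i=1}^n w_iC_i$, and $WCT_{OPT}$ denotes its minimum over all schedules. LRF (Largest-Ratio-First) algorithm: the tasks are indexed so that $\frac{w_1}{\tau_1}\ge\cdots\ge\frac{w_n}{\tau_n}$ (ties in any order); initialize $\mathcal{S}_j=\emptyset$ and $EW_j=\frac{2}{\lambda_j}$ for all $j$; for $i=1,\dots,n$ in turn, pick $j_{\min}=\arg\min_k EW_k$, add $s_i$ to $\mathcal{S}_{j_{\min}}$ and increase $EW_{j_{\min}}$ by $\tau_i$. Each worker processes its tasks in the order they were assigned. *)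

theory Defs
  imports Complex_Main "HOL-Library.Disjoint_Sets"
begin

text \<open>Workers are numbered \<open>1..m\<close> and tasks \<open>1..n\<close>. Worker \<open>j\<close> has rate \<open>lam j\<close>; task \<open>i\<close> has
  service time \<open>tau i\<close> and weight \<open>w i\<close>. Only the values at these indices are meaningful.\<close>

definition valid_instance ::
    "nat \<Rightarrow> nat \<Rightarrow> (nat \<Rightarrow> real) \<Rightarrow> (nat \<Rightarrow> real) \<Rightarrow> (nat \<Rightarrow> real) \<Rightarrow> bool" where
  "valid_instance m n lam tau w \<longleftrightarrow> m \<ge> 1 \<and>
     (\<forall>j\<in>{1..m}. lam j > 0) \<and> (\<forall>i\<in>{1..n}. tau i > 0) \<and> (\<forall>i\<in>{1..n}. w i > 0)"

text \<open>A schedule maps each worker to the list of its tasks in processing order. It is fixed to be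
  empty outside \<open>1..m\<close>, so that there are only finitely many schedules.\<close>

definition schedules :: "nat \<Rightarrow> nat \<Rightarrow> (nat \<Rightarrow> nat list) set" where
  "schedules m n = {S. (\<forall>j\<in>{1..m}. distinct (S j)) \<and>
     disjoint_family_on (\<lambda>j. set (S j)) {1..m} \<and>
     (\<Union>j\<in>{1..m}. set (S j)) = {1..n} \<and>
     (\<forall>j. j \<notin> {1..m} \<longrightarrow> S j = [])}"

definition worker_of :: "nat \<Rightarrow> (nat \<Rightarrow> nat list) \<Rightarrow> nat \<Rightarrow> nat" where
  "worker_of m S i = (THE j. j \<in> {1..m} \<and> i \<in> set (S j))"

definition completion_time ::
    "nat \<Rightarrow> (nat \<Rightarrow> real) \<Rightarrow> (nat \<Rightarrow> real) \<Rightarrow> (nat \<Rightarrow> nat list) \<Rightarrow> nat \<Rightarrow> real" where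
  "completion_time m lam tau S i = (let j = worker_of m S i in
     2 / lam j + ((\<Sum>k\<leftarrow>takeWhile (\<lambda>k. k \<noteq> i) (S j). tau k) + tau i))"

definition wct :: "nat \<Rightarrow> nat \<Rightarrow> (nat \<Rightarrow> real) \<Rightarrow> (nat \<Rightarrow> real) \<Rightarrow> (nat \<Rightarrow> real) \<Rightarrow>
    (nat \<Rightarrow> nat list) \<Rightarrow> real" where
  "wct m n lam tau w S = (\<Sum>i=1..n. w i * completion_time m lam tau S i)"

definition wct_opt ::
    "nat \<Rightarrow> nat \<Rightarrow> (nat \<Rightarrow> real) \<Rightarrow> (nat \<Rightarrow> real) \<Rightarrow> (nat \<Rightarrow> real) \<Rightarrow> real" where
  "wct_opt m n lam tau w = Min (wct m n lam tau w ` schedules m n)"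

text \<open>\<open>lrf_state m lam tau i S EW\<close>: some run of the greedy loop has, after the first \<open>i\<close> tasks,
  the assignment \<open>S\<close> and the accumulated times \<open>EW\<close>. This is a relation because the argmin need
  not be unique; any minimizer may be picked.\<close>

inductive lrf_state :: "nat \<Rightarrow> (nat \<Rightarrow> real) \<Rightarrow> (nat \<Rightarrow> real) \<Rightarrow> nat \<Rightarrow>
    (nat \<Rightarrow> nat list) \<Rightarrow> (nat \<Rightarrow> real) \<Rightarrow> bool"
  for m :: nat and lam tau :: "nat \<Rightarrow> real" where
  init: "lrf_state m lam tau 0 (\<lambda>_. []) (\<lambda>j. 2 / lam j)"
| step: "lrf_state m lam tau i S EW \<Longrightarrow> is_arg_min EW (\<lambda>k. k \<in> {1..m}) j \<Longrightarrow>
    lrf_state m lam tau (Suc i) (S(j := S j @ [Suc i])) (EW(j := EW j + tau (Suc i)))"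

definition lrf_output ::
    "nat \<Rightarrow> nat \<Rightarrow> (nat \<Rightarrow> real) \<Rightarrow> (nat \<Rightarrow> real) \<Rightarrow> (nat \<Rightarrow> nat list) \<Rightarrow> bool" where
  "lrf_output m n lam tau S \<longleftrightarrow> (\<exists>EW. lrf_state m lam tau n S EW)"

text \<open>\<open>wct_opt\<close> is a minimum over a finite nonempty set, and the algorithm yields schedules.\<close>

lemma finite_schedules: "finite (schedules m n)"
proof (rule finite_subset)
  let ?B = "{xs. set xs \<subseteq> {1..n} \<and> distinct xs}"
  show "schedules m n \<subseteq> {S. \<forall>j. (j \<in> {1..m} \<longrightarrow> S j \<in> ?B) \<and> (j \<notin> {1..m} \<longrightarrow> S j = [])}"
    unfolding schedules_def by blast
  have "finite ?B"
  proof (rule finite_subset)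
    show "?B \<subseteq> {xs. set xs \<subseteq> {1..n} \<and> length xs \<le> n}"
    proof safe
      fix xs :: "nat list" assume *: "set xs \<subseteq> {1..n}" "distinct xs"
      show "length xs \<le> n"
        using card_mono[OF _ *(1)] distinct_card[OF *(2)] by simp
    qed
    show "finite {xs. set xs \<subseteq> {1..n} \<and> length xs \<le> n}"
      by (rule finite_lists_length_le) simp
  qed
  then show "finite {S. \<forall>j. (j \<in> {1..m} \<longrightarrow> S j \<in> ?B) \<and> (j \<notin> {1..m} \<longrightarrow> S j = [])}"
    by (intro finite_set_of_finite_funs) auto
qed

lemma lrf_state_schedules: "lrf_state m lam tau i S EW \<Longrightarrow> S \<in> schedules m i"
proof (induction rule: lrf_state.induct)
  case init
  then show ?case by (auto simp: schedules_def disjoint_family_on_def)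
next
  case (step i S EW j)
  have j: "j \<in> {1..m}" using step.hyps(2) by (simp add: is_arg_min_def)
  have S: "\<forall>j\<in>{1..m}. distinct (S j)" "disjoint_family_on (\<lambda>j. set (S j)) {1..m}"
    "(\<Union>j\<in>{1..m}. set (S j)) = {1..i}" "\<forall>j. j \<notin> {1..m} \<longrightarrow> S j = []"
    using step.IH by (auto simp: schedules_def)
  have new: "Suc i \<notin> set (S k)" if "k \<in> {1..m}" for k
  proof
    assume "Suc i \<in> set (S k)"
    then have "Suc i \<in> {1..i}" using S(3) that by blast
    then show False by simp
  qed
  have "(\<Union>k\<in>{1..m}. set ((S(j := S j @ [Suc i])) k)) = insert (Suc i) (\<Union>k\<in>{1..m}. set (S k))"
    using j by (auto split: if_splits)
  also have "\<dots> = {1..Suc i}" unfolding S(3) by auto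
  finally have U: "(\<Union>k\<in>{1..m}. set ((S(j := S j @ [Suc i])) k)) = {1..Suc i}" .
  have D: "disjoint_family_on (\<lambda>k. set ((S(j := S j @ [Suc i])) k)) {1..m}"
    unfolding disjoint_family_on_def
  proof (intro ballI impI)
    fix a b assume ab: "a \<in> {1..m}" "b \<in> {1..m}" "a \<noteq> b"
    have "set (S a) \<inter> set (S b) = {}" using S(2) ab by (auto simp: disjoint_family_on_def)
    then show "set ((S(j := S j @ [Suc i])) a) \<inter> set ((S(j := S j @ [Suc i])) b) = {}"
      using new[OF ab(1)] new[OF ab(2)] ab(3) by auto
  qed
  have "\<forall>k\<in>{1..m}. distinct ((S(j := S j @ [Suc i])) k)" using S(1) new by auto
  moreover have "\<forall>k. k \<notin> {1..m} \<longrightarrow> (S(j := S j @ [Suc i])) k = []" using S(4) j by auto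
  ultimately show ?case unfolding schedules_def using U D by blast
qed

lemma lrf_output_schedules: "lrf_output m n lam tau S \<Longrightarrow> S \<in> schedules m n"
  unfolding lrf_output_def using lrf_state_schedules by blast

lemma lrf_output_exists:
  assumes "m \<ge> 1"
  shows "\<exists>S. lrf_output m n lam tau S"
  unfolding lrf_output_def
proof (induction n)
  case 0
  show ?case using lrf_state.init by blast
next
  case (Suc n)
  then obtain S EW where run: "lrf_state m lam tau n S EW" by blast
  obtain j where "is_arg_min EW (\<lambda>k. k \<in> {1..m}) j"
    using ex_is_arg_min_if_finite[of "{1..m}" EW] assms by auto
  from lrf_state.step[OF run this] show ?case by blast
qed

lemma schedules_nonempty: "m \<ge> 1 \<Longrightarrow> schedules m n \<noteq> {}"
  using lrf_output_exists lrf_output_schedules by blast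

end

theory Submission imports Defs begin

text \<open>The term \<open>M\<^sub>\<Lambda>\<close> charges every task the start-up time of the worker that LRF gives it, but an
  optimal schedule may pair tasks and workers differently. Two workers with start-up times \<open>1\<close> and
  \<open>3/2\<close> and two tasks with \<open>w = \<tau> = 1\<close> and \<open>w = \<tau> = 2\<close> suffice: LRF sends the light task to the
  fast worker and the heavy one to the slow worker, so the claimed bound is
  \<open>7/2 + 5/4 + 4 = 35/4\<close>, whereas exchanging the two tasks costs only \<open>5/2 + 6 = 17/2\<close>.\<close>

lemma wct_opt_le: "T \<in> schedules m n \<Longrightarrow> wct_opt m n lam tau w \<le> wct m n lam tau w T"
  unfolding wct_opt_def by (intro Min_le finite_imageI finite_schedules imageI)

text \<open>Disjointness of the task sets makes the \<open>THE\<close> in \<open>worker_of\<close>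
  unique.\<close>

lemma worker_of_eq:
  assumes "T \<in> schedules m n" "j \<in> {1..m}" "i \<in> set (T j)"
  shows "worker_of m T i = j"
  unfolding worker_of_def
proof (rule the_equality)
  fix k assume "k \<in> {1..m} \<and> i \<in> set (T k)"
  moreover have "disjoint_family_on (\<lambda>j. set (T j)) {1..m}"
    using assms(1) by (simp add: schedules_def)
  ultimately show "k = j"
    using assms(2,3) unfolding disjoint_family_on_def by blast
qed (use assms in auto)

theorem theorem1:
  "\<exists>(m::nat) (n::nat) (lam :: nat \<Rightarrow> real) (tau :: nat \<Rightarrow> real) (w :: nat \<Rightarrow> real)
      (S :: nat \<Rightarrow> nat list).
     valid_instance m n lam tau w \<and>
     antimono_on {1..n} (\<lambda>i. w i / tau i) \<and>
     lrf_output m n lam tau S \<and>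
     (let M\<^sub>1 = (\<Sum>j=1..n. \<Sum>i=1..j. w j * tau i);
          M\<^sub>n = (\<Sum>i=1..n. w i * tau i);
          M\<^sub>\<Lambda> = (\<Sum>j=1..m. \<Sum>i\<in>set (S j). w i * (2 / lam j))
      in wct_opt m n lam tau w
           < 1 / real m * M\<^sub>1 + (real m - 1) / (2 * real m) * M\<^sub>n + M\<^sub>\<Lambda>)"
proof -
  \<comment> \<open>The start-up times \<open>2 / lam j\<close> are \<open>(j + 1) / 2\<close>, that
    is 1 and 3/2. Below, \<open>real\<close> serves as both \<open>tau\<close> and \<open>w\<close>,
    so all ratios are 1.\<close>
  define lam :: "nat \<Rightarrow> real" where "lam = (\<lambda>j. 4 / (real j + 1))"
  define S :: "nat \<Rightarrow> nat list" where "S = (\<lambda>_. [])(1 := [1], 2 := [2])"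
  define T :: "nat \<Rightarrow> nat list" where "T = (\<lambda>_. [])(1 := [2], 2 := [1])"
  \<comment> \<open>The simplifier turns the lower bound \<open>1\<close> into \<open>Suc 0\<close>,
    hence this form.\<close>
  have two: "{Suc 0..2} = {1, 2::nat}" by auto
  have valid: "valid_instance 2 2 lam real real"
    by (auto simp: valid_instance_def lam_def)
  have mono: "antimono_on {1..2} (\<lambda>i. real i / real i)"
    by (auto simp: monotone_on_def two)
  have lrf: "lrf_output 2 2 lam real S"
  proof -
    \<comment> \<open>Left unsimplified to match the conclusion of
      \<open>lrf_state.step\<close>.\<close>
    let ?S = "(\<lambda>_. [])(1 :: nat := [] @ [Suc 0])"
    let ?EW = "(\<lambda>j. 2 / lam j)(1 := 2 / lam 1 + real (Suc 0))"
    have "lrf_state 2 lam real (Suc 0) ?S ?EW"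
      by (intro lrf_state.intros) (auto simp: is_arg_min_def lam_def two)
    \<comment> \<open>Worker 1 is now busy until 2, while worker 2 is free at 3/2.\<close>
    moreover have "is_arg_min ?EW (\<lambda>k. k \<in> {1..2}) 2"
      by (auto simp: is_arg_min_def lam_def two)
    ultimately have "lrf_state 2 lam real (Suc (Suc 0))
        (?S(2 := ?S 2 @ [Suc (Suc 0)])) (?EW(2 := ?EW 2 + real (Suc (Suc 0))))"
      by (rule lrf_state.step)
    then show ?thesis
      by (auto simp: lrf_output_def S_def numeral_2_eq_2)
  qed
  have T: "T \<in> schedules 2 2"
    by (auto simp: schedules_def T_def disjoint_family_on_def two)
  have "worker_of 2 T 1 = 2" "worker_of 2 T 2 = 1"
    by (rule worker_of_eq[OF T]; simp add: T_def)+
  then have "wct 2 2 lam real real T = 17 / 2"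
    by (simp add: wct_def two completion_time_def Let_def T_def lam_def)
  then have "wct_opt 2 2 lam real real \<le> 17 / 2"
    using wct_opt_le[OF T, of lam real real] by simp
  moreover have "(\<Sum>j=1..2. \<Sum>i=1..j. real j * real i) = 7"
    by (simp add: two)
  moreover have "(\<Sum>i=1..2. real i * real i) = 5"
    by (simp add: two)
  moreover have "(\<Sum>j=1..2. \<Sum>i\<in>set (S j). real i * (2 / lam j)) = 4"
    by (simp add: two S_def lam_def)
  ultimately show ?thesis
    using valid mono lrf
    by (intro exI[of _ 2] exI[of _ lam] exI[of _ real] exI[of _ S]) (simp add: Let_def)
qed

end
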